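(* For every $n\geq 1$, the chromatic number $\pi_n$ of the $n$-dimensional permutohedron (with respect to proper colourings of its facets) equals $n$.
   Context: For $n\geq 1$ let $[n]=\{1,\ldots,n\}$ and $[n]_0=\{0,1,\ldots,n\}$. A building set is a collection $\mathcal{B}$ of nonempty subsets of $[n]_0$ containing all singletons $\{x\}$, $x\in[n]_0$, such that $S_1,S_2\in\mathcal{B}$ and $S_1\cap S_2\neq\emptyset$ imply $S_1\cup S_2\in\mathcal{B}$. For a family of sets $N$, an $N$-antichain is a subset $\{X_1,\ldots,X_m\}\subseteq N$ with $m\geq 2$ whose members are mutually incomparable with respect to $\subseteq$. Assuming $[n]_0\in\mathcal{B}$, a set $N\subseteq\mathcal{B}$ is nested when the union of every $N$-antichain is not an element of $\mathcal{B}$. The nested-set complex of $\mathcal{B}$ is the simplicial complex of all nested sets $N$ with $[n]_0\notin N$. It is realised by a simple $n$-dimensional polytope (the nestohedron of $\mathcal{B}$): its face lattice with the bottom (the empty face) removed is isomorphic to the complex ordered by $\supseteq$. Hence its facets are identified with the elements $X\in\mathcal{B}$, $X\neq[n]_0$, and two facets have a common vertex iff some nested set contains both. The $n$-dimensional permutohedron is the nestohedron of the building set of all nonempty connected subsets of vertices of the complete graph on $[n]_0$, i.e. of all nonempty subsets of $[n]_0$. Two facets of a polytope are separated when they have no vertex in common. For $\mathcal{F}$ the set of facets of a polytope, a function $f\colon\mathcal{F}\to[m]$ is a proper colouring when every two (distinct) facets of the same colour are separated. The chromatic number of the polytope is the minimal $m$ such that a proper colouring of its facets with $m$ colours exists.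 *)

theory Defs
  imports "HOL-Analysis.Analysis"
begin

text \<open>Building sets on $[n]_0$, which is \<open>{0..n}\<close>.\<close>

definition building_set :: "nat \<Rightarrow> nat set set \<Rightarrow> bool" where
  "building_set n B \<longleftrightarrow>
     (\<forall>X\<in>B. X \<noteq> {} \<and> X \<subseteq> {0..n}) \<and>
     (\<forall>x\<in>{0..n}. {x} \<in> B) \<and>
     (\<forall>X\<in>B. \<forall>Y\<in>B. X \<inter> Y \<noteq> {} \<longrightarrow> X \<union> Y \<in> B)"

text \<open>An infinite \<open>A\<close> is excluded by \<open>card A \<ge> 2\<close>.\<close>

definition antichain_in :: "'a set set \<Rightarrow> 'a set set \<Rightarrow> bool" where
  "antichain_in N A \<longleftrightarrow>
     A \<subseteq> N \<and> card A \<ge> 2 \<and> pairwise (\<lambda>X Y. \<not> X \<subseteq> Y \<and> \<not> Y \<subseteq> X) A"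

definition nested_set :: "'a set set \<Rightarrow> 'a set set \<Rightarrow> bool" where
  "nested_set B N \<longleftrightarrow> N \<subseteq> B \<and> (\<forall>A. antichain_in N A \<longrightarrow> \<Union>A \<notin> B)"

definition nested_set_complex :: "nat \<Rightarrow> nat set set \<Rightarrow> nat set set set" where
  "nested_set_complex n B = {N. nested_set B N \<and> {0..n} \<notin> N}"

definition simple_polytope :: "'a::euclidean_space set \<Rightarrow> bool" where
  "simple_polytope P \<longleftrightarrow>
     polytope P \<and>
     (\<forall>v. v extreme_point_of P \<longrightarrow> int (card {F. F facet_of P \<and> v \<in> F}) = aff_dim P)"

text \<open>The nestohedron is determined only up to combinatorial equivalence, so it is
  rendered as a property of \<open>P\<close>: being a realisation of the nested-set complex. The
  faces below include \<open>P\<close> itself, which corresponds to the empty nested set.\<close>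

definition nestohedron :: "nat \<Rightarrow> nat set set \<Rightarrow> 'a::euclidean_space set \<Rightarrow> bool" where
  "nestohedron n B P \<longleftrightarrow>
     building_set n B \<and> {0..n} \<in> B \<and>
     simple_polytope P \<and> aff_dim P = int n \<and>
     (\<exists>\<phi>. bij_betw \<phi> {F. F face_of P \<and> F \<noteq> {}} (nested_set_complex n B) \<and>
          (\<forall>F G. F face_of P \<and> F \<noteq> {} \<and> G face_of P \<and> G \<noteq> {} \<longrightarrow>
             (F \<subseteq> G \<longleftrightarrow> \<phi> F \<supseteq> \<phi> G)))"

text \<open>Every nonempty vertex set is connected in the complete graph on \<open>{0..n}\<close>.\<close>

definition permutohedron :: "nat \<Rightarrow> 'a::euclidean_space set \<Rightarrow> bool" where
  "permutohedron n P \<longleftrightarrow> nestohedron n {X. X \<noteq> {} \<and> X \<subseteq> {0..n}} P"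

definition separated_facets :: "'a::euclidean_space set \<Rightarrow> 'a set \<Rightarrow> 'a set \<Rightarrow> bool" where
  "separated_facets P F G \<longleftrightarrow> \<not> (\<exists>v. v extreme_point_of P \<and> v \<in> F \<and> v \<in> G)"

definition proper_facet_colouring ::
    "'a::euclidean_space set \<Rightarrow> nat \<Rightarrow> ('a set \<Rightarrow> nat) \<Rightarrow> bool" where
  "proper_facet_colouring P m f \<longleftrightarrow>
     f \<in> {F. F facet_of P} \<rightarrow> {1..m} \<and>
     (\<forall>F G. F facet_of P \<and> G facet_of P \<and> F \<noteq> G \<and> f F = f G \<longrightarrow> separated_facets P F G)"

text \<open>For a polytope the minimum exists, as there are finitely many facets.\<close>

definition facet_chromatic_number :: "'a::euclidean_space set \<Rightarrow> nat" where
  "facet_chromatic_number P = (LEAST m. \<exists>f. proper_facet_colouring P m f)"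

end

theory Submission imports Defs begin

text \<open>
  In the building set of all nonempty subsets of \<open>{0..n}\<close> any union of one or more members is a
  member, so a set is nested exactly when it is a chain. Since facets correspond to the members of
  the building set other than \<open>{0..n}\<close>, and two of them meet in a vertex iff some nested set
  contains both (\<open>nestohedron_facets\<close>), colouring the facets of the permutohedron means colouring
  the nonempty proper subsets of \<open>{0..n}\<close> so that distinct comparable sets get different colours
  (\<open>permutohedron_facets\<close>). This is the comparability graph of a ranked poset: the cardinality
  is a proper colouring with values in \<open>{1..n}\<close>, and the \<open>n\<close> members of the chain
  \<open>{0} \<subset> {0,1} \<subset> \<dots> \<subset> {0..n-1}\<close> need pairwise different colours.
\<close>

section \<open>Nested sets and chains\<close>

lemma nested_set_subset:
  assumes "nested_set B N" and "M \<subseteq> N"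
  shows "nested_set B M"
  using assms unfolding nested_set_def antichain_in_def by blast

lemma nested_set_singleton:
  assumes "X \<in> B"
  shows "nested_set B {X}"
proof -
  have False if "antichain_in {X} A" for A
    using that card_mono[of "{X}" A] by (auto simp: antichain_in_def)
  with assms show ?thesis
    unfolding nested_set_def by blast
qed

lemma nested_set_iff_chain:
  "nested_set {X. X \<noteq> {} \<and> X \<subseteq> S} N \<longleftrightarrow>
     (\<forall>X\<in>N. X \<noteq> {} \<and> X \<subseteq> S) \<and> (\<forall>X\<in>N. \<forall>Y\<in>N. X \<subseteq> Y \<or> Y \<subseteq> X)"
  (is "?l \<longleftrightarrow> ?r")
proof
  assume l: ?l
  then have sub: "\<forall>X\<in>N. X \<noteq> {} \<and> X \<subseteq> S"
    by (auto simp: nested_set_def)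
  have "X \<subseteq> Y \<or> Y \<subseteq> X" if "X \<in> N" "Y \<in> N" for X Y
  proof (rule ccontr)
    assume "\<not> (X \<subseteq> Y \<or> Y \<subseteq> X)"
    then have "antichain_in N {X, Y}"
      using that by (auto simp: antichain_in_def pairwise_def card_insert_if)
    with l have "\<Union>{X, Y} \<notin> {X. X \<noteq> {} \<and> X \<subseteq> S}"
      unfolding nested_set_def by blast
    with sub that show False by auto
  qed
  with sub show ?r by blast
next
  assume r: ?r
  have False if A: "antichain_in N A" for A
  proof -
    from A have card: "card A \<ge> 2" by (simp add: antichain_in_def)
    then have "finite A" by (intro card_ge_0_finite) simp
    with card obtain X Y where "X \<in> A" "Y \<in> A" "X \<noteq> Y"
      using card_le_Suc0_iff_eq[of A] by fastforce
    moreover from this A have "\<not> X \<subseteq> Y \<and> \<not> Y \<subseteq> X"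
      unfolding antichain_in_def by (blast dest: pairwiseD)
    moreover have "A \<subseteq> N" using A by (simp add: antichain_in_def)
    ultimately show False
      using r by (meson subsetD)
  qed
  moreover from r have "N \<subseteq> {X. X \<noteq> {} \<and> X \<subseteq> S}" by blast
  ultimately show ?l
    unfolding nested_set_def by blast
qed

section \<open>Facets of nestohedra\<close>

text \<open>
  The face lattice of a polytope determines which faces are facets: they are the maximal proper
  ones. Under the anti-isomorphism they become the minimal nonempty nested sets, which are the
  singletons because nestedness passes to subsets. A vertex lying on two facets is itself a face,
  whose nested set contains both labels; conversely a nested set with both labels yields a
  nonempty common face, which has a vertex.
\<close>

lemma nestohedron_facets:
  fixes P :: "'a::euclidean_space set"
  assumes "nestohedron n B P"
  shows "\<exists>\<psi>. bij_betw \<psi> {F. F facet_of P} (B - {{0..n}}) \<and>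
    (\<forall>F G. F facet_of P \<and> G facet_of P \<longrightarrow>
       (separated_facets P F G \<longleftrightarrow>
          (\<nexists>N. N \<in> nested_set_complex n B \<and> \<psi> F \<in> N \<and> \<psi> G \<in> N)))"
proof -
  let ?K = "nested_set_complex n B"
  let ?\<F> = "{F. F face_of P \<and> F \<noteq> {}}"
  from assms obtain \<phi> where
    poly: "polytope P" and dim: "aff_dim P = int n" and
    bij: "bij_betw \<phi> ?\<F> ?K" and
    anti: "\<And>F G. F \<in> ?\<F> \<Longrightarrow> G \<in> ?\<F> \<Longrightarrow> F \<subseteq> G \<longleftrightarrow> \<phi> G \<subseteq> \<phi> F"
    unfolding nestohedron_def simple_polytope_def by auto
  have conv: "convex P" and cpt: "compact P" and phd: "polyhedron P"
    using poly by (simp_all add: polytope_imp_convex polytope_imp_compact polytope_imp_polyhedron)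
  have "P \<noteq> {}" using dim by auto
  with conv have P: "P \<in> ?\<F>" by (simp add: face_of_refl)
  have inK: "\<phi> F \<in> ?K" if "F \<in> ?\<F>" for F
    using bij that by (rule bij_betw_apply)
  have inj: "F = G" if "F \<in> ?\<F>" "G \<in> ?\<F>" "\<phi> F = \<phi> G" for F G
    using bij that by (auto simp: bij_betw_def inj_on_def)
  have surj: "\<exists>F\<in>?\<F>. \<phi> F = N" if "N \<in> ?K" for N
  proof -
    from that have "N \<in> \<phi> ` ?\<F>" by (simp only: bij_betw_imp_surj_on[OF bij])
    then show ?thesis by blast
  qed
  have subK: "M \<in> ?K" if "N \<in> ?K" "M \<subseteq> N" for M N
    using that nested_set_subset[of B N M] by (auto simp: nested_set_complex_def)
  have KB: "N \<subseteq> B - {{0..n}}" if "N \<in> ?K" for N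
    using that by (auto simp: nested_set_complex_def nested_set_def)
  have sgl: "{X} \<in> ?K" if "X \<in> B - {{0..n}}" for X
    using that nested_set_singleton[of X B] by (auto simp: nested_set_complex_def)
  have face: "F \<in> ?\<F>" "F \<noteq> P" if "F facet_of P" for F
    using that by (auto simp: facet_of_def)
  have top: "\<phi> P = {}"
  proof -
    have "{} \<in> ?K" using subK[OF inK[OF P]] by blast
    then obtain F where "F \<in> ?\<F>" "\<phi> F = {}" using surj by blast
    with anti[of F P] P show ?thesis
      using face_of_imp_subset by auto
  qed
  have ne: "\<phi> F \<noteq> {}" if "F facet_of P" for F
    using inj[OF face(1)[OF that] P] face(2)[OF that] top by auto

  have single: "\<exists>X. \<phi> F = {X}" if F: "F facet_of P" for F
  proof -
    from ne[OF F] obtain X where X: "X \<in> \<phi> F" by blast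
    then have "{X} \<in> ?K" using subK[OF inK[OF face(1)[OF F]]] by blast
    then obtain G where G: "G \<in> ?\<F>" "\<phi> G = {X}" using surj by blast
    have FG: "F \<subseteq> G" using anti[OF face(1)[OF F] G(1)] G(2) X by simp
    have "G \<noteq> P" using G(2) top by auto
    then have "aff_dim G < aff_dim P"
      using face_of_aff_dim_lt[OF conv] G(1) by auto
    moreover have "F face_of G"
      using face_of_subset[of F P G] face(1)[OF F] FG G(1) face_of_imp_subset by auto
    moreover have "convex G" using G(1) face_of_imp_convex by auto
    ultimately have "F = G"
      using face_of_aff_dim_lt[of G F] F by (force simp: facet_of_def)
    with G(2) show ?thesis by blast
  qed

  have facet: "\<exists>F. F facet_of P \<and> \<phi> F = {X}" if X: "X \<in> B - {{0..n}}" for X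
  proof -
    obtain G where G: "G \<in> ?\<F>" "\<phi> G = {X}" using surj[OF sgl[OF X]] by blast
    have "G \<noteq> P" using G(2) top by auto
    then obtain F where F: "F facet_of P" "G \<subseteq> F"
      using face_of_polyhedron_subset_facet[OF phd] G(1) by blast
    have "\<phi> F \<subseteq> {X}" using anti[OF G(1) face(1)[OF F(1)]] F(2) G(2) by simp
    with ne[OF F(1)] F(1) show ?thesis by blast
  qed

  define \<psi> where "\<psi> = (\<lambda>F. the_elem (\<phi> F))"
  have \<psi>: "\<phi> F = {\<psi> F}" if "F facet_of P" for F
    using single[OF that] by (auto simp: \<psi>_def)

  have "bij_betw \<psi> {F. F facet_of P} (B - {{0..n}})"
    unfolding bij_betw_def
  proof (intro conjI subset_antisym subsetI)
    show "inj_on \<psi> {F. F facet_of P}"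
      using inj face(1) \<psi> by (metis (no_types, lifting) inj_onI mem_Collect_eq)
  next
    fix X assume "X \<in> \<psi> ` {F. F facet_of P}"
    then obtain F where "F facet_of P" "X = \<psi> F" by blast
    then show "X \<in> B - {{0..n}}" using KB[OF inK[OF face(1)]] \<psi> by blast
  next
    fix X assume "X \<in> B - {{0..n}}"
    then obtain F where "F facet_of P" "\<phi> F = {X}" using facet by blast
    with \<psi> show "X \<in> \<psi> ` {F. F facet_of P}" by force
  qed
  moreover have "separated_facets P F G \<longleftrightarrow> (\<nexists>N. N \<in> ?K \<and> \<psi> F \<in> N \<and> \<psi> G \<in> N)"
    if F: "F facet_of P" and G: "G facet_of P" for F G
  proof -
    have below: "H \<subseteq> F \<longleftrightarrow> \<psi> F \<in> \<phi> H" "H \<subseteq> G \<longleftrightarrow> \<psi> G \<in> \<phi> H" if "H \<in> ?\<F>" for H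
      using anti[OF that face(1)[OF F]] anti[OF that face(1)[OF G]] \<psi>[OF F] \<psi>[OF G] by auto
    have "(\<exists>v. v extreme_point_of P \<and> v \<in> F \<and> v \<in> G) \<longleftrightarrow> (\<exists>H\<in>?\<F>. H \<subseteq> F \<and> H \<subseteq> G)"
    proof
      assume "\<exists>v. v extreme_point_of P \<and> v \<in> F \<and> v \<in> G"
      then obtain v where "v extreme_point_of P" "v \<in> F" "v \<in> G" by blast
      then have "{v} \<in> ?\<F> \<and> {v} \<subseteq> F \<and> {v} \<subseteq> G" by (simp add: face_of_singleton)
      then show "\<exists>H\<in>?\<F>. H \<subseteq> F \<and> H \<subseteq> G" by blast
    next
      assume "\<exists>H\<in>?\<F>. H \<subseteq> F \<and> H \<subseteq> G"
      then obtain H where H: "H face_of P" "H \<noteq> {}" "H \<subseteq> F" "H \<subseteq> G" by blast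
      have "compact H" "convex H"
        using H(1) conv cpt face_of_imp_compact face_of_imp_convex by blast+
      then obtain v where v: "v extreme_point_of H"
        using H(2) extreme_point_exists_convex by blast
      then have "v extreme_point_of P" "v \<in> H"
        using extreme_point_of_face[OF H(1)] by blast+
      with H show "\<exists>v. v extreme_point_of P \<and> v \<in> F \<and> v \<in> G" by blast
    qed
    also have "\<dots> \<longleftrightarrow> (\<exists>H\<in>?\<F>. \<psi> F \<in> \<phi> H \<and> \<psi> G \<in> \<phi> H)"
      using below by (intro bex_cong) simp_all
    also have "\<dots> \<longleftrightarrow> (\<exists>N. N \<in> ?K \<and> \<psi> F \<in> N \<and> \<psi> G \<in> N)"
      unfolding bij_betw_imp_surj_on[OF bij, symmetric] by blast
    finally show ?thesis by (simp add: separated_facets_def)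
  qed
  ultimately show ?thesis
    by (intro exI[of _ \<psi>] conjI allI impI) simp_all
qed

lemma permutohedron_facets:
  fixes P :: "'a::euclidean_space set"
  assumes "permutohedron n P"
  shows "\<exists>\<psi>. bij_betw \<psi> {F. F facet_of P} {X. X \<noteq> {} \<and> X \<subset> {0..n}} \<and>
    (\<forall>F G. F facet_of P \<and> G facet_of P \<longrightarrow>
       (separated_facets P F G \<longleftrightarrow> \<not> (\<psi> F \<subseteq> \<psi> G \<or> \<psi> G \<subseteq> \<psi> F)))"
proof -
  let ?B = "{X. X \<noteq> {} \<and> X \<subseteq> {0..n}}"
  have B: "?B - {{0..n}} = {X. X \<noteq> {} \<and> X \<subset> {0..n}}" by auto
  from assms have "nestohedron n ?B P" by (simp add: permutohedron_def)
  from nestohedron_facets[OF this] obtain \<psi> where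
    bij: "bij_betw \<psi> {F. F facet_of P} (?B - {{0..n}})" and
    sep: "\<forall>F G. F facet_of P \<and> G facet_of P \<longrightarrow>
       (separated_facets P F G \<longleftrightarrow>
          (\<nexists>N. N \<in> nested_set_complex n ?B \<and> \<psi> F \<in> N \<and> \<psi> G \<in> N))"
    by (elim exE conjE) (rule that)
  have "(\<exists>N. N \<in> nested_set_complex n ?B \<and> \<psi> F \<in> N \<and> \<psi> G \<in> N) \<longleftrightarrow> \<psi> F \<subseteq> \<psi> G \<or> \<psi> G \<subseteq> \<psi> F"
    (is "?l \<longleftrightarrow> ?r") if F: "F facet_of P" and G: "G facet_of P" for F G
  proof
    assume ?l
    then show ?r
      unfolding nested_set_complex_def nested_set_iff_chain by blast
  next
    assume ?r
    moreover have "\<psi> F \<in> ?B - {{0..n}}" "\<psi> G \<in> ?B - {{0..n}}"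
      using bij_betw_apply[OF bij, of F] bij_betw_apply[OF bij, of G] F G by simp_all
    ultimately have "{\<psi> F, \<psi> G} \<in> nested_set_complex n ?B"
      unfolding nested_set_complex_def nested_set_iff_chain by blast
    then show ?l by blast
  qed
  with sep have "\<forall>F G. F facet_of P \<and> G facet_of P \<longrightarrow>
       (separated_facets P F G \<longleftrightarrow> \<not> (\<psi> F \<subseteq> \<psi> G \<or> \<psi> G \<subseteq> \<psi> F))"
    by simp
  with bij show ?thesis
    unfolding B by (intro exI[of _ \<psi>] conjI)
qed

section \<open>The chromatic number\<close>

theorem mainTheorem1:
  fixes n :: nat and P :: "'a::euclidean_space set"
  assumes "n \<ge> 1" and "permutohedron n P"
  shows "facet_chromatic_number P = n"
proof -
  from permutohedron_facets[OF assms(2)] obtain \<psi> where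
    bij: "bij_betw \<psi> {F. F facet_of P} {X. X \<noteq> {} \<and> X \<subset> {0..n}}" and
    all: "\<forall>F G. F facet_of P \<and> G facet_of P \<longrightarrow>
       (separated_facets P F G \<longleftrightarrow> \<not> (\<psi> F \<subseteq> \<psi> G \<or> \<psi> G \<subseteq> \<psi> F))"
    by (elim exE conjE) (rule that)
  have sep: "separated_facets P F G \<longleftrightarrow> \<not> (\<psi> F \<subseteq> \<psi> G \<or> \<psi> G \<subseteq> \<psi> F)"
    if "F facet_of P" "G facet_of P" for F G
    using all that by simp
  have label: "\<psi> F \<noteq> {}" "\<psi> F \<subset> {0..n}" if "F facet_of P" for F
    using bij_betw_apply[OF bij] that by auto
  have "proper_facet_colouring P n (\<lambda>F. card (\<psi> F))"
    unfolding proper_facet_colouring_def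
  proof (intro conjI allI impI Pi_I)
    fix F assume "F \<in> {F. F facet_of P}"
    then have *: "\<psi> F \<noteq> {}" "\<psi> F \<subset> {0..n}" using label by auto
    then have "finite (\<psi> F)" using finite_subset by blast
    with * psubset_card_mono[OF _ *(2)] show "card (\<psi> F) \<in> {1..n}"
      by (auto simp: Suc_le_eq card_gt_0_iff)
  next
    fix F G
    assume *: "F facet_of P \<and> G facet_of P \<and> F \<noteq> G \<and> card (\<psi> F) = card (\<psi> G)"
    then have "\<psi> F \<noteq> \<psi> G"
      using bij by (auto simp: bij_betw_def inj_on_def)
    moreover have "finite (\<psi> F)" "finite (\<psi> G)"
      using * label finite_subset[of _ "{0..n}"] by blast+
    ultimately show "separated_facets P F G"
      using * sep[of F G] card_subset_eq[of "\<psi> F" "\<psi> G"] card_subset_eq[of "\<psi> G" "\<psi> F"]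
      by auto
  qed
  moreover have "n \<le> m" if m: "proper_facet_colouring P m f" for m f
  proof -
    define g where "g i = inv_into {F. F facet_of P} \<psi> {..<Suc i}" for i
    have g: "g i facet_of P" "\<psi> (g i) = {..<Suc i}" if "i < n" for i
    proof -
      have "0 \<in> {..<Suc i}" "{..<Suc i} \<subseteq> {0..n}" "n \<in> {0..n} - {..<Suc i}"
        using that by auto
      then have "{..<Suc i} \<in> {X. X \<noteq> {} \<and> X \<subset> {0..n}}" by blast
      then have "{..<Suc i} \<in> \<psi> ` {F. F facet_of P}"
        by (simp only: bij_betw_imp_surj_on[OF bij])
      from inv_into_into[OF this] f_inv_into_f[OF this]
      show "g i facet_of P" "\<psi> (g i) = {..<Suc i}"
        by (simp_all only: g_def mem_Collect_eq)
    qed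
    have "inj_on (\<lambda>i. f (g i)) {..<n}"
    proof (rule inj_onI)
      fix i j assume *: "i \<in> {..<n}" "j \<in> {..<n}" "f (g i) = f (g j)"
      have "\<not> separated_facets P (g i) (g j)"
        using * sep[of "g i" "g j"] g[of i] g[of j] by auto
      then have "g i = g j"
        using m * g(1)[of i] g(1)[of j] unfolding proper_facet_colouring_def
        by (meson lessThan_iff)
      then have "\<psi> (g i) = \<psi> (g j)" by (rule arg_cong)
      moreover have "\<psi> (g i) = {..<Suc i}" "\<psi> (g j) = {..<Suc j}"
        using g(2)[of i] g(2)[of j] * by (simp_all only: lessThan_iff)
      ultimately have "{..<Suc i} = {..<Suc j}" by (simp only:)
      then show "i = j" by simp
    qed
    moreover have "(\<lambda>i. f (g i)) ` {..<n} \<subseteq> {1..m}"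
    proof (rule image_subsetI)
      fix i assume "i \<in> {..<n}"
      then have "g i \<in> {F. F facet_of P}" using g(1) by simp
      then show "f (g i) \<in> {1..m}"
        using m unfolding proper_facet_colouring_def by (blast intro: funcset_mem)
    qed
    ultimately have "card {..<n} \<le> card {1..m}"
      by (rule card_inj_on_le) simp
    then show ?thesis by simp
  qed
  ultimately show ?thesis
    unfolding facet_chromatic_number_def by (intro Least_equality) auto
qed

end
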